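(* Let $M$ be a uniform matroid of rank $r$ on a ground set $E=\{e_1,\dots,e_n\}$, let $k\ge1$, and let $\mathcal{D}$ be a product distribution in which $e_i$ is active independently with probability $p_i$, where $p_1\ge p_2\ge\dots\ge p_n$. Assume $\mathrm{OPT}\ge 200$. Then the algorithm described in the context is a $\Theta(1)$-approximation algorithm for the portfolio problem on this instance: there is an absolute constant $c>0$ such that the expected value (over the algorithm's randomness) of its output portfolio is at least $c\cdot\mathrm{OPT}$.
   Context: A portfolio is a collection $\{S_1,\dots,S_k\}$ of subsets of $E$ each of size at most $r$; its value is $\mathbb{E}_{A}[\max_{i\in[k]}|S_i\cap A|]$ where $A$ is the random set of active elements; $\mathrm{OPT}$ is the maximum value over all portfolios. The algorithm: for each $i=1,\dots,n$, form a portfolio from the prefix $\{e_1,\dots,e_i\}$ by, $k$ times independently, drawing $r$ elements uniformly at random with replacement from the prefix and keeping the set of distinct drawn elements; then estimate the values of these $n$ portfolios (by sampling from $\mathcal{D}$) and return the one with the largest estimated value. *)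

theory Defs
  imports "HOL-Probability.Probability"
begin

text \<open>
  The ground set \<open>{e\<^sub>1, \<dots>, e\<^sub>n}\<close> is identified with its index set \<open>{1..n}\<close>.
  A portfolio \<open>{S\<^sub>1, \<dots>, S\<^sub>k}\<close> is a list of length \<open>k\<close>; the order is immaterial for
  its value, and repeated sets are allowed.
\<close>

definition uniform_matroid_indep :: "nat set \<Rightarrow> nat \<Rightarrow> nat set set" where
  "uniform_matroid_indep E r = {S. S \<subseteq> E \<and> card S \<le> r}"

definition portfolios :: "nat \<Rightarrow> nat \<Rightarrow> nat \<Rightarrow> nat set list set" where
  "portfolios n r k =
     {P. length P = k \<and> set P \<subseteq> uniform_matroid_indep {1..n} r}"

definition active_set_pmf :: "nat \<Rightarrow> (nat \<Rightarrow> real) \<Rightarrow> nat set pmf" where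
  "active_set_pmf n p =
     map_pmf (\<lambda>f. {i \<in> {1..n}. f i}) (Pi_pmf {1..n} False (\<lambda>i. bernoulli_pmf (p i)))"

definition realized_value :: "nat set list \<Rightarrow> nat set \<Rightarrow> real" where
  "realized_value P A = real (Max ((\<lambda>S. card (S \<inter> A)) ` set P))"

definition portfolio_value :: "nat set pmf \<Rightarrow> nat set list \<Rightarrow> real" where
  "portfolio_value D P = measure_pmf.expectation D (realized_value P)"

definition OPT :: "nat \<Rightarrow> nat \<Rightarrow> nat \<Rightarrow> nat set pmf \<Rightarrow> real" where
  "OPT n r k D = Max (portfolio_value D ` portfolios n r k)"

text \<open>
  \<open>pmf_of_set {1..i}\<close> is the uniform distribution on the prefix (for \<open>i \<ge> 1\<close>), and
  \<open>replicate_pmf\<close> draws independently, hence with replacement.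
\<close>

definition random_set :: "nat \<Rightarrow> nat \<Rightarrow> nat set pmf" where
  "random_set r i = map_pmf set (replicate_pmf r (pmf_of_set {1..i}))"

definition random_portfolio :: "nat \<Rightarrow> nat \<Rightarrow> nat \<Rightarrow> nat set list pmf" where
  "random_portfolio r k i = replicate_pmf k (random_set r i)"

definition estimate_value :: "nat \<Rightarrow> nat set pmf \<Rightarrow> nat set list \<Rightarrow> real pmf" where
  "estimate_value N D P =
     map_pmf (\<lambda>As. (\<Sum>A\<leftarrow>As. realized_value P A) / real N) (replicate_pmf N D)"

text \<open>
  The distribution of the output when each of the \<open>n\<close> candidates is estimated by the mean
  of \<open>N\<close> samples from \<open>D\<close>, drawn afresh for every candidate. Ties between estimates are broken
  by the unspecified choice underlying \<^const>\<open>arg_max_on\<close>.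
\<close>

definition portfolio_algorithm ::
    "nat \<Rightarrow> nat \<Rightarrow> nat \<Rightarrow> nat set pmf \<Rightarrow> nat \<Rightarrow> nat set list pmf" where
  "portfolio_algorithm n r k D N =
     do {
       P \<leftarrow> Pi_pmf {1..n} [] (random_portfolio r k);
       est \<leftarrow> Pi_pmf {1..n} 0 (\<lambda>i. estimate_value N D (P i));
       return_pmf (P (arg_max_on est {1..n}))
     }"

lemma set_pmf_portfolio_algorithm_subset:
  assumes "n \<ge> 1"
  shows "set_pmf (portfolio_algorithm n r k D N) \<subseteq> portfolios n r k"
proof
  fix Q assume "Q \<in> set_pmf (portfolio_algorithm n r k D N)"
  then obtain P and est :: "nat \<Rightarrow> real"
    where P: "P \<in> set_pmf (Pi_pmf {1..n} [] (random_portfolio r k))"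
      and Q: "Q = P (arg_max_on est {1..n})"
    by (auto simp: portfolio_algorithm_def)
  define j where "j = arg_max_on est {1..n}"
  obtain m where "m \<in> {1..n}" "\<And>i. i \<in> {1..n} \<Longrightarrow> est i \<le> est m"
    using obtains_MAX[of "{1..n}" est] assms by (metis Max_ge atLeastAtMost_iff
        finite_atLeastAtMost finite_imageI imageI empty_iff order_refl)
  then have "is_arg_max est (\<lambda>x. x \<in> {1..n}) m"
    by (auto simp: is_arg_max_linorder)
  then have "is_arg_max est (\<lambda>x. x \<in> {1..n}) j"
    unfolding j_def arg_max_on_def arg_max_def by (rule someI)
  then have j: "j \<in> {1..n}"
    by (simp add: is_arg_max_def)
  have "Q \<in> set_pmf (random_portfolio r k j)"
    using P j Q by (auto simp: set_Pi_pmf PiE_dflt_def j_def)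
  then have len: "length Q = k" and sub: "set Q \<subseteq> set_pmf (random_set r j)"
    by (auto simp: random_portfolio_def set_replicate_pmf)
  have "S \<in> uniform_matroid_indep {1..n} r" if "S \<in> set_pmf (random_set r j)" for S
  proof -
    have fin: "set_pmf (pmf_of_set {1..j}) = {1..j}"
      using j by (intro set_pmf_of_set) auto
    from that obtain xs where xs: "S = set xs" "length xs = r" "set xs \<subseteq> {1..j}"
      unfolding random_set_def set_map_pmf set_replicate_pmf fin by auto
    then show ?thesis
      using j card_length[of xs] by (auto simp: uniform_matroid_indep_def)
  qed
  then show "Q \<in> portfolios n r k"
    using len sub by (auto simp: portfolios_def)
qed

end

theory Submission
  imports Defs
begin

text \<open>
  Let \<open>V = OPT\<close> and let \<open>i\<close> be the shortest prefix length whose expected number of active elements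
  is at least \<open>V / 4\<close>. All later elements are active with probability at most the average \<open>q\<close> over this
  prefix, and the earlier ones account for at most \<open>V / 4\<close>. Hence in the optimal portfolio the remaining parts
  of the \<open>k\<close> sets, dominated by binomial variables with parameters \<open>r\<close> and \<open>q\<close>, have to account for the rest,
  and this forces \<open>k \<cdot> Pr[Bin(r, q) \<ge> s] \<ge> 1 / 2\<close> for \<open>s = \<lfloor>V / 4\<rfloor>\<close>. Conversely, given the active set, the \<open>k\<close> random
  sets drawn from the prefix are independent, and as long as fewer than \<open>t \<approx> s / 16\<close> active elements have been
  collected, each draw hits a new one with probability at least \<open>q / 4\<close>. Thinning \<open>Bin(r, q)\<close> by \<open>1 / 4\<close> then shows
  that one of the \<open>k\<close> sets reaches \<open>t\<close> with constant probability. The selection by estimates loses at most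
  twice the total estimation error, which is a constant smaller than \<open>V / 1000\<close>.
\<close>

subsection \<open>Binomial tails\<close>

abbreviation E :: "'a pmf \<Rightarrow> ('a \<Rightarrow> real) \<Rightarrow> real" where
  "E \<equiv> measure_pmf.expectation"

text \<open>The probability that a binomial variable with parameters \<open>r\<close> and \<open>q\<close> is at least \<open>t\<close>.\<close>

fun binomial_tail :: "real \<Rightarrow> nat \<Rightarrow> nat \<Rightarrow> real" where
  "binomial_tail q r 0 = 1"
| "binomial_tail q 0 (Suc t) = 0"
| "binomial_tail q (Suc r) (Suc t) = q * binomial_tail q r t + (1 - q) * binomial_tail q r (Suc t)"

lemma binomial_tail_bounds:
  assumes "0 \<le> q" "q \<le> 1"
  shows "0 \<le> binomial_tail q r t" "binomial_tail q r t \<le> 1"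
proof -
  have "0 \<le> binomial_tail q r t \<and> binomial_tail q r t \<le> 1"
    using assms
  proof (induction q r t rule: binomial_tail.induct)
    case (3 q r t)
    then have "q * binomial_tail q r t + (1 - q) * binomial_tail q r (Suc t) \<le> q * 1 + (1 - q) * 1"
      by (intro add_mono mult_left_mono) auto
    with 3 show ?case by auto
  qed auto
  then show "0 \<le> binomial_tail q r t" "binomial_tail q r t \<le> 1" by auto
qed

lemma binomial_tail_Suc_le:
  assumes "0 \<le> q" "q \<le> 1"
  shows "binomial_tail q r (Suc t) \<le> binomial_tail q r t"
  using assms
proof (induction q r t rule: binomial_tail.induct)
  case (1 q r)
  then show ?case using binomial_tail_bounds[of q r "Suc 0"] by simp
next
  case (3 q r t)
  then show ?case by (auto intro!: add_mono mult_left_mono)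
qed auto

lemma binomial_tail_le_Suc:
  assumes "0 \<le> q" "q \<le> 1"
  shows "binomial_tail q r t \<le> binomial_tail q (Suc r) t"
proof (cases t)
  case (Suc u)
  have "q * binomial_tail q r (Suc u) \<le> q * binomial_tail q r u"
    using assms binomial_tail_Suc_le by (intro mult_left_mono) auto
  then show ?thesis using Suc by (simp add: algebra_simps)
qed simp

lemma binomial_tail_mono:
  assumes "0 \<le> q" "q \<le> 1" "r \<le> r'"
  shows "binomial_tail q r t \<le> binomial_tail q r' t"
  using assms(3) binomial_tail_le_Suc[OF assms(1,2)]
  by (induction r' rule: dec_induct) (auto intro: order_trans)

text \<open>Once \<open>s\<close> successes have occurred, at most \<open>r\<close> trials remain
  for the other \<open>u\<close>. In the recursion on \<open>s\<close> the factor for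
  \<open>u\<close> is carried along unchanged, and it is raised from \<open>r\<close> to
  \<open>Suc r\<close> trials only at the end.\<close>

lemma binomial_tail_submultiplicative:
  assumes "0 \<le> q" "q \<le> 1"
  shows "binomial_tail q r (s + u) \<le> binomial_tail q r s * binomial_tail q r u"
  using assms
proof (induction q r s rule: binomial_tail.induct)
  case (3 q r s)
  have "binomial_tail q (Suc r) (Suc s + u)
      = q * binomial_tail q r (s + u) + (1 - q) * binomial_tail q r (Suc s + u)"
    by simp
  also have "\<dots> \<le> q * (binomial_tail q r s * binomial_tail q r u)
      + (1 - q) * (binomial_tail q r (Suc s) * binomial_tail q r u)"
    using 3 by (intro add_mono mult_left_mono) auto
  also have "\<dots> = binomial_tail q (Suc r) (Suc s) * binomial_tail q r u"
    by (simp add: algebra_simps)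
  also have "\<dots> \<le> binomial_tail q (Suc r) (Suc s) * binomial_tail q (Suc r) u"
    using 3 by (intro mult_left_mono binomial_tail_le_Suc binomial_tail_bounds)
  finally show ?case .
qed auto

text \<open>The tails at 1, 2, ... sum to the mean r q; all of them are nonnegative, so a truncated
  sum stays below it.\<close>

lemma sum_binomial_tail_le:
  assumes "0 \<le> q" "q \<le> 1"
  shows "(\<Sum>u<m. binomial_tail q r (Suc u)) \<le> real r * q"
proof (induction r arbitrary: m)
  case (Suc r)
  show ?case
  proof (cases m)
    case (Suc l)
    have "(\<Sum>u<m. binomial_tail q (Suc r) (Suc u))
        = q * (\<Sum>u<Suc l. binomial_tail q r u) + (1 - q) * (\<Sum>u<m. binomial_tail q r (Suc u))"
      by (simp add: Suc sum.distrib sum_distrib_left del: sum.lessThan_Suc)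
    \<comment> \<open>The shift splits off the tail at 0, which equals 1 and accounts for the first
      trial itself.\<close>
    also have "(\<Sum>u<Suc l. binomial_tail q r u) = 1 + (\<Sum>u<l. binomial_tail q r (Suc u))"
      by (subst sum.lessThan_Suc_shift) simp
    also have "q * (1 + (\<Sum>u<l. binomial_tail q r (Suc u))) + (1 - q) * (\<Sum>u<m. binomial_tail q r (Suc u))
        \<le> q * (1 + real r * q) + (1 - q) * (real r * q)"
      using assms Suc.IH by (intro add_mono mult_left_mono) auto
    finally show ?thesis by (simp add: algebra_simps)
  qed (use assms in simp)
qed simp

text \<open>Keep each success of Bin(r, q) independently with probability \<theta>: the kept ones
  form Bin(r, \<theta> q). Having \<open>s\<close> successes and keeping \<open>t\<close> of the
  first \<open>s\<close> is one way to keep at least \<open>t\<close>.\<close>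

lemma binomial_tail_thinning:
  assumes "0 \<le> q" "q \<le> 1" "0 \<le> \<theta>" "\<theta> \<le> 1"
  shows "binomial_tail q r s * binomial_tail \<theta> s t \<le> binomial_tail (\<theta> * q) r t"
proof (induction r arbitrary: s t)
  case 0
  then show ?case by (cases s; cases t) auto
next
  case (Suc r)
  have th: "0 \<le> \<theta> * q" "\<theta> * q \<le> 1" using assms by (auto intro: mult_le_one)
  show ?case
  proof (cases t)
    case 0
    then show ?thesis using binomial_tail_bounds[OF assms(1,2), of "Suc r" s] by simp
  next
    case t: (Suc t')
    show ?thesis
    proof (cases s)
      case 0
      then show ?thesis using t binomial_tail_bounds[OF th, of "Suc r" "Suc t'"] by simp
    next
      case s: (Suc s')
      \<comment> \<open>The three summands: the first trial succeeds and is kept, succeeds and is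
        discarded, or fails.\<close>
      have "binomial_tail q (Suc r) s * binomial_tail \<theta> s t
        = (q * \<theta>) * (binomial_tail q r s' * binomial_tail \<theta> s' t')
          + (q * (1 - \<theta>)) * (binomial_tail q r s' * binomial_tail \<theta> s' t)
          + (1 - q) * (binomial_tail q r s * binomial_tail \<theta> s t)"
        by (simp add: s t algebra_simps)
      also have "\<dots> \<le> (q * \<theta>) * binomial_tail (\<theta> * q) r t'
          + (q * (1 - \<theta>)) * binomial_tail (\<theta> * q) r t + (1 - q) * binomial_tail (\<theta> * q) r t"
        using assms Suc.IH by (intro add_mono mult_left_mono) auto
      also have "\<dots> = binomial_tail (\<theta> * q) (Suc r) t"
        by (simp add: t algebra_simps)
      finally show ?thesis .
    qed
  qed
qed

text \<open>Markov's inequality for \<open>2\<^sup>-\<^sup>X\<close> with \<open>X\<close> binomial, carried out inside the recursion.\<close>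

lemma binomial_tail_ge_power:
  assumes "0 \<le> q" "q \<le> 1"
  shows "1 - binomial_tail q r t \<le> 2 ^ t * (1 - q / 2) ^ r"
  using assms
proof (induction q r t rule: binomial_tail.induct)
  case (3 q r t)
  have "1 - binomial_tail q (Suc r) (Suc t)
      = q * (1 - binomial_tail q r t) + (1 - q) * (1 - binomial_tail q r (Suc t))"
    by (simp add: algebra_simps)
  also have "\<dots> \<le> q * (2 ^ t * (1 - q / 2) ^ r) + (1 - q) * (2 ^ Suc t * (1 - q / 2) ^ r)"
    using 3 by (intro add_mono mult_left_mono) auto
  also have "\<dots> = 2 ^ Suc t * (1 - q / 2) ^ Suc r"
    by (simp add: algebra_simps)
  finally show ?case .
next
  case (2 q t)
  show ?case using one_le_power[of "2::real" "Suc t"] by simp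
qed simp

lemma exp_neg_one_le_half: "exp (- 1 :: real) \<le> 1 / 2"
  using exp_ge_add_one_self[of "1::real"] by (simp add: exp_minus field_simps)

lemma two_power_le_exp: "2 ^ t \<le> exp (real t)"
  using power_mono[of 2 "exp (1::real)" t] exp_ge_add_one_self[of "1::real"]
  by (simp add: exp_of_nat_mult[symmetric])

lemma binomial_tail_ge_half:
  assumes "0 \<le> q" "q \<le> 1" "4 * real t \<le> real r * q" "1 \<le> t"
  shows "1 / 2 \<le> binomial_tail q r t"
proof -
  have "(1 - q / 2) ^ r \<le> exp (- (q / 2)) ^ r"
    using assms exp_ge_add_one_self[of "- (q / 2)"] by (intro power_mono) auto
  then have "2 ^ t * (1 - q / 2) ^ r \<le> exp (real t) * exp (- (q / 2)) ^ r"
    using assms two_power_le_exp[of t] by (intro mult_mono) auto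
  also have "\<dots> = exp (real t - real r * q / 2)"
    by (simp add: exp_of_nat_mult[symmetric] exp_add[symmetric] algebra_simps)
  \<comment> \<open>Since r q / 2 is at least 2 t, the exponent is at most -t, hence at most
    -1.\<close>
  also have "\<dots> \<le> exp (- 1)" using assms by auto
  finally show ?thesis
    using binomial_tail_ge_power[OF assms(1,2), of r t] exp_neg_one_le_half by linarith
qed

subsection \<open>Independent subsets and random portfolios\<close>

lemma expectation_bind_pmf_finite:
  assumes "finite (set_pmf M)" "\<And>x. x \<in> set_pmf M \<Longrightarrow> finite (set_pmf (K x))"
  shows "E (bind_pmf M K) f = E M (\<lambda>x. E (K x) f)"
  using assms by (subst pmf_expectation_bind[of "set_pmf M"]) (auto simp: integral_measure_pmf)

lemma expectation_swap:
  assumes "finite (set_pmf M)" "finite (set_pmf K)"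
  shows "E M (\<lambda>x. E K (\<lambda>y. f x y)) = E K (\<lambda>y. E M (\<lambda>x. f x y))"
  using assms
  by (simp add: integral_measure_pmf[OF assms(1)] integral_measure_pmf[OF assms(2)]
      sum_distrib_left mult.left_commute sum.swap[of _ "set_pmf M"])

lemma expectation_mono_finite:
  assumes "finite (set_pmf M)" "\<And>x. x \<in> set_pmf M \<Longrightarrow> f x \<le> g x"
  shows "E M f \<le> E M g"
  using assms by (intro integral_mono_AE integrable_measure_pmf_finite AE_pmfI) auto

lemma finite_set_replicate_pmf:
  assumes "finite (set_pmf M)"
  shows "finite (set_pmf (replicate_pmf k M))"
  using finite_lists_length_eq[OF assms, of k]
  by (simp add: set_replicate_pmf lists_eq_set conj_commute)

lemma finite_set_Pi_pmf:
  assumes "finite I" "\<And>i. i \<in> I \<Longrightarrow> finite (set_pmf (M i))"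
  shows "finite (set_pmf (Pi_pmf I d M))"
  using assms by (simp add: set_Pi_pmf finite_PiE_dflt)

lemma expectation_Pi_pmf_component:
  assumes "finite I" "i \<in> I"
  shows "E (Pi_pmf I d M) (\<lambda>x. f (x i)) = E (M i) f"
proof -
  have "E (map_pmf (\<lambda>x. x i) (Pi_pmf I d M)) f = E (M i) f"
    using assms by (simp add: Pi_pmf_component del: integral_map_pmf)
  then show ?thesis by simp
qed

text \<open>The active set over an arbitrary index set, so that inductions can add one element at a
  time and restrictions to subsets have the same form.\<close>

definition independent_subset :: "'a set \<Rightarrow> ('a \<Rightarrow> real) \<Rightarrow> 'a set pmf" where
  "independent_subset I p = map_pmf (\<lambda>f. {i \<in> I. f i}) (Pi_pmf I False (\<lambda>i. bernoulli_pmf (p i)))"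

lemma active_set_pmf_eq: "active_set_pmf n p = independent_subset {1..n} p"
  by (simp add: active_set_pmf_def independent_subset_def)

lemma set_independent_subset:
  "set_pmf (independent_subset I p) \<subseteq> Pow I"
  by (auto simp: independent_subset_def)

lemma finite_set_independent_subset:
  "finite I \<Longrightarrow> finite (set_pmf (independent_subset I p))"
  by (rule finite_subset[OF set_independent_subset]) simp

lemma card_insert_independent_subset:
  assumes "finite I" "x \<notin> I" "A \<in> set_pmf (independent_subset I p)"
  shows "card (insert x A) = Suc (card A)"
proof -
  have "A \<subseteq> I" using assms(3) set_independent_subset by blast
  then show ?thesis using assms(1,2) by (meson card_insert_disjoint finite_subset subsetD)
qed

lemma independent_subset_empty: "independent_subset {} p = return_pmf {}"
  by (simp add: independent_subset_def)

text \<open>The coins of elements in \<open>S\<close> are independent of the others, so a set of the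
  portfolio can be studied on its own elements alone.\<close>

lemma independent_subset_Int:
  assumes "finite I" "S \<subseteq> I"
  shows "map_pmf ((\<inter>) S) (independent_subset I p) = independent_subset S p"
  using assms
  by (auto simp: independent_subset_def Pi_pmf_subset[OF assms] pmf.map_comp
      intro!: map_pmf_cong)

lemma expectation_independent_subset_Int:
  assumes "finite I" "S \<subseteq> I"
  shows "E (independent_subset I p) (\<lambda>A. f (S \<inter> A)) = E (independent_subset S p) f"
  by (simp flip: independent_subset_Int[OF assms])

lemma expectation_independent_subset_insert:
  assumes "finite I" "x \<notin> I" "0 \<le> p x" "p x \<le> 1"
  shows "E (independent_subset (insert x I) p) f
    = p x * E (independent_subset I p) (\<lambda>A. f (insert x A))
      + (1 - p x) * E (independent_subset I p) f"
proof -
  have eq: "{i \<in> insert x I. (g(x := b)) i} = (if b then insert x {i \<in> I. g i} else {i \<in> I. g i})"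
    for g b using assms(2) by auto
  have fin: "finite (set_pmf (independent_subset I p))"
    using assms by (intro finite_set_independent_subset)
  have "independent_subset (insert x I) p = do {
      b \<leftarrow> bernoulli_pmf (p x);
      map_pmf (\<lambda>A. if b then insert x A else A) (independent_subset I p)}"
    unfolding independent_subset_def Pi_pmf_insert'[OF assms(1,2)] map_pmf_def bind_assoc_pmf
      bind_return_pmf eq ..
  then show ?thesis
    using assms fin by (simp add: expectation_bind_pmf_finite)
qed

lemma expectation_card_independent_subset:
  assumes "finite I" "\<And>i. i \<in> I \<Longrightarrow> 0 \<le> p i \<and> p i \<le> 1"
  shows "E (independent_subset I p) (\<lambda>A. real (card A)) = (\<Sum>i\<in>I. p i)"
  using assms
proof (induction I rule: finite_induct)
  case (insert x I)
  have fin: "finite (set_pmf (independent_subset I p))"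
    using insert by (intro finite_set_independent_subset)
  have "E (independent_subset I p) (\<lambda>A. real (card (insert x A)))
      = E (independent_subset I p) (\<lambda>A. 1 + real (card A))"
    using insert.hyps
    by (intro integral_cong_AE AE_pmfI) (simp_all add: card_insert_independent_subset)
  also have "\<dots> = 1 + (\<Sum>i\<in>I. p i)"
    using insert fin by (simp add: integrable_measure_pmf_finite)
  finally show ?case
    using insert by (simp add: expectation_independent_subset_insert algebra_simps)
qed (simp add: independent_subset_empty)

lemma tail_independent_subset_insert:
  assumes "finite I" "x \<notin> I" "0 \<le> p x" "p x \<le> 1"
  shows "E (independent_subset (insert x I) p) (\<lambda>A. of_bool (Suc t \<le> card A))
    = p x * E (independent_subset I p) (\<lambda>A. of_bool (t \<le> card A))
      + (1 - p x) * E (independent_subset I p) (\<lambda>A. of_bool (Suc t \<le> card A))"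
proof -
  have "E (independent_subset I p) (\<lambda>A. of_bool (Suc t \<le> card (insert x A)))
      = E (independent_subset I p) (\<lambda>A. of_bool (t \<le> card A))"
    using assms(1,2)
    by (intro integral_cong_AE AE_pmfI) (simp_all add: card_insert_independent_subset)
  then show ?thesis
    using assms by (simp add: expectation_independent_subset_insert)
qed

text \<open>Stochastic domination: raising every activity probability to \<open>q\<close> can only
  increase the tail, and the probabilities are raised one element at a time.\<close>

lemma tail_independent_subset_le:
  assumes "finite I" "\<And>i. i \<in> I \<Longrightarrow> 0 \<le> p i \<and> p i \<le> q" "0 \<le> q" "q \<le> 1"
  shows "E (independent_subset I p) (\<lambda>A. of_bool (t \<le> card A)) \<le> binomial_tail q (card I) t"
  using assms
proof (induction I arbitrary: t rule: finite_induct)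
  case empty
  then show ?case by (cases t) (auto simp: independent_subset_empty)
next
  case (insert x I)
  show ?case
  proof (cases t)
    case 0
    then show ?thesis by simp
  next
    case (Suc u)
    have px: "0 \<le> p x" "p x \<le> q" "p x \<le> 1" using insert.prems(1)[of x] insert.prems(3) by auto
    have "E (independent_subset (insert x I) p) (\<lambda>A. of_bool (t \<le> card A))
        = p x * E (independent_subset I p) (\<lambda>A. of_bool (u \<le> card A))
        + (1 - p x) * E (independent_subset I p) (\<lambda>A. of_bool (t \<le> card A))"
      unfolding Suc using insert px by (intro tail_independent_subset_insert) auto
    also have "\<dots> \<le> p x * binomial_tail q (card I) u + (1 - p x) * binomial_tail q (card I) t"
      using insert px by (intro add_mono mult_left_mono) auto
    \<comment> \<open>In this form \<open>p x\<close> multiplies a nonnegative difference of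
      consecutive tails and may be replaced by \<open>q\<close>.\<close>
    also have "\<dots> = binomial_tail q (card I) t + p x * (binomial_tail q (card I) u - binomial_tail q (card I) t)"
      by (simp add: algebra_simps)
    also have "\<dots> \<le> binomial_tail q (card I) t + q * (binomial_tail q (card I) u - binomial_tail q (card I) t)"
      using px insert.prems binomial_tail_Suc_le[of q "card I" u]
      by (intro add_mono mult_right_mono) (auto simp: Suc)
    also have "\<dots> = binomial_tail q (card (insert x I)) t"
      using insert.hyps by (simp add: Suc algebra_simps)
    finally show ?thesis .
  qed
qed

text \<open>Markov's inequality for 2 to the power of minus the cardinality, now with unequal
  probabilities: each element contributes a factor 1 - p / 2, which is at most exp (- p /
  2).\<close>

lemma tail_independent_subset_ge:
  assumes "finite I" "\<And>i. i \<in> I \<Longrightarrow> 0 \<le> p i \<and> p i \<le> 1"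
  shows "1 - E (independent_subset I p) (\<lambda>A. of_bool (t \<le> card A)) \<le> 2 ^ t * exp (- (\<Sum>i\<in>I. p i) / 2)"
  using assms
proof (induction I arbitrary: t rule: finite_induct)
  case empty
  then show ?case by (cases "t = 0") (simp_all add: independent_subset_empty)
next
  case (insert x I)
  show ?case
  proof (cases t)
    case 0
    then show ?thesis by simp
  next
    case (Suc u)
    let ?P = "\<lambda>t. E (independent_subset I p) (\<lambda>A. of_bool (t \<le> card A))"
    have px: "0 \<le> p x" "p x \<le> 1" using insert by auto
    have "1 - E (independent_subset (insert x I) p) (\<lambda>A. of_bool (t \<le> card A))
        = p x * (1 - ?P u) + (1 - p x) * (1 - ?P t)"
      unfolding Suc tail_independent_subset_insert[where p = p, OF insert.hyps(1,2) px]
      by (simp add: algebra_simps)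
    also have "\<dots> \<le> p x * (2 ^ u * exp (- (\<Sum>i\<in>I. p i) / 2)) + (1 - p x) * (2 ^ t * exp (- (\<Sum>i\<in>I. p i) / 2))"
      using px insert.prems by (intro add_mono mult_left_mono insert.IH) auto
    also have "\<dots> = (2 ^ t * exp (- (\<Sum>i\<in>I. p i) / 2)) * (1 - p x / 2)"
      by (simp add: Suc algebra_simps)
    also have "\<dots> \<le> (2 ^ t * exp (- (\<Sum>i\<in>I. p i) / 2)) * exp (- p x / 2)"
      using exp_ge_add_one_self[of "- p x / 2"] by (intro mult_left_mono) auto
    also have "\<dots> = 2 ^ t * exp (- (\<Sum>i\<in>insert x I. p i) / 2)"
      using insert.hyps by (simp add: exp_add[symmetric] field_simps)
    finally show ?thesis .
  qed
qed

section \<open>Independent draws with replacement\<close>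

lemma expectation_replicate_pmf_Suc:
  assumes "finite (set_pmf M)"
  shows "E (replicate_pmf (Suc k) M) f = E M (\<lambda>x. E (replicate_pmf k M) (\<lambda>xs. f (x # xs)))"
proof -
  have "replicate_pmf (Suc k) M = bind_pmf M (\<lambda>x. map_pmf ((#) x) (replicate_pmf k M))"
    by (simp add: map_pmf_def)
  then show ?thesis
    using assms by (simp add: expectation_bind_pmf_finite finite_set_replicate_pmf del: replicate_pmf.simps)
qed

lemma expectation_ex_replicate_pmf:
  assumes "finite (set_pmf M)"
  shows "E (replicate_pmf k M) (\<lambda>xs. of_bool (\<exists>x\<in>set xs. Q x))
    = 1 - (1 - E M (\<lambda>x. of_bool (Q x))) ^ k"
proof (induction k)
  case (Suc k)
  let ?q = "E M (\<lambda>x. of_bool (Q x))"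
  have "E (replicate_pmf k M) (\<lambda>xs. of_bool (\<exists>y\<in>set (x # xs). Q y))
      = 1 - (1 - ?q) ^ k + (1 - ?q) ^ k * of_bool (Q x)" for x
    using Suc by (cases "Q x") simp_all
  then have "E (replicate_pmf (Suc k) M) (\<lambda>xs. of_bool (\<exists>x\<in>set xs. Q x))
      = E M (\<lambda>x. 1 - (1 - ?q) ^ k + (1 - ?q) ^ k * of_bool (Q x))"
    using assms by (simp only: expectation_replicate_pmf_Suc)
  also have "\<dots> = 1 - (1 - ?q) ^ k + (1 - ?q) ^ k * ?q"
    using assms by (simp add: integrable_measure_pmf_finite)
  finally show ?case by (simp add: algebra_simps)
qed simp

text \<open>While fewer than \<open>t\<close> elements of \<open>B\<close> have been collected, more
  than \<open>card B - t\<close> are still missing, so each draw finds a new one with probability at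
  least \<rho>. The induction deletes a hit element from \<open>B\<close> and lowers
  \<open>t\<close> by one, which leaves \<open>card B - t\<close> and hence \<rho>
  unchanged.\<close>

lemma tail_random_set_ge:
  assumes "1 \<le> i" "B \<subseteq> {1..i}" "t \<le> card B" "0 \<le> \<rho>" "\<rho> * real i \<le> real (card B) - real t"
  shows "binomial_tail \<rho> r t \<le> E (random_set r i) (\<lambda>S. of_bool (t \<le> card (S \<inter> B)))"
  using assms(2-)
proof (induction r arbitrary: B t)
  case 0
  then show ?case by (cases t) (auto simp: random_set_def)
next
  case (Suc r)
  let ?U = "pmf_of_set {1..i}"
  have fin: "finite (set_pmf ?U)" using assms by simp
  have finB: "finite B" using Suc.prems by (auto intro: finite_subset)
  have "card B \<le> i" using card_mono[OF _ Suc.prems(1)] by simp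
  then have "\<rho> * real i \<le> 1 * real i" using Suc.prems by simp
  then have \<rho>: "\<rho> \<le> 1" using assms(1) by simp
  show ?case
  proof (cases t)
    case 0
    then show ?thesis by (simp add: random_set_def)
  next
    case (Suc u)
    \<comment> \<open>Condition on the first draw \<open>x\<close>: a hit leaves the target
      \<open>u\<close> in \<open>B - {x}\<close>, a miss leaves the problem as it was with one draw
      fewer.\<close>
    have step: "(if x \<in> B then binomial_tail \<rho> r u else binomial_tail \<rho> r t)
        \<le> E (replicate_pmf r ?U) (\<lambda>xs. of_bool (t \<le> card (set (x # xs) \<inter> B)))" for x
    proof (cases "x \<in> B")
      case True
      have card_Suc: "card (set (x # xs) \<inter> B) = Suc (card (set xs \<inter> (B - {x})))" for xs
      proof -
        have "set (x # xs) \<inter> B = insert x (set xs \<inter> (B - {x}))" using True by auto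
        then show ?thesis by (simp only:) simp
      qed
      have "binomial_tail \<rho> r u \<le> E (random_set r i) (\<lambda>S. of_bool (u \<le> card (S \<inter> (B - {x}))))"
        using Suc Suc.prems True finB by (intro Suc.IH) auto
      also have "\<dots> = E (replicate_pmf r ?U) (\<lambda>xs. of_bool (u \<le> card (set xs \<inter> (B - {x}))))"
        by (simp add: random_set_def)
      also have "\<dots> = E (replicate_pmf r ?U) (\<lambda>xs. of_bool (t \<le> card (set (x # xs) \<inter> B)))"
        by (simp only: Suc card_Suc Suc_le_mono)
      finally show ?thesis using True by simp
    next
      case False
      then show ?thesis using Suc.IH[OF Suc.prems] by (simp add: random_set_def)
    qed
    have "\<rho> \<le> real (card B) / real i"
      using Suc.prems assms(1) by (simp add: field_simps)
    \<comment> \<open>The true hit probability \<open>card B / i\<close> is at least \<rho>, and it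
      multiplies a nonnegative difference of tails.\<close>
    then have "binomial_tail \<rho> (Suc r) t \<le> binomial_tail \<rho> r t
        + real (card B) / real i * (binomial_tail \<rho> r u - binomial_tail \<rho> r t)"
      using mult_right_mono[of \<rho> "real (card B) / real i" "binomial_tail \<rho> r u - binomial_tail \<rho> r t"]
        binomial_tail_Suc_le[of \<rho> r u] \<rho> Suc.prems by (simp add: Suc algebra_simps)
    also have "\<dots> = E ?U (\<lambda>x. if x \<in> B then binomial_tail \<rho> r u else binomial_tail \<rho> r t)"
      using assms(1) Suc.prems(1) \<open>card B \<le> i\<close> finB
      by (simp add: integral_pmf_of_set sum.If_cases Int_absorb1 card_Diff_subset
          Diff_eq[symmetric] field_simps)
    also have "\<dots> \<le> E ?U (\<lambda>x. E (replicate_pmf r ?U) (\<lambda>xs. of_bool (t \<le> card (set (x # xs) \<inter> B))))"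
      using fin step by (intro expectation_mono_finite)
    also have "\<dots> = E (random_set (Suc r) i) (\<lambda>S. of_bool (t \<le> card (S \<inter> B)))"
      using fin by (simp add: random_set_def expectation_replicate_pmf_Suc del: replicate_pmf.simps)
    finally show ?thesis .
  qed
qed

subsection \<open>A good prefix\<close>

text \<open>The indicators count the levels above \<open>s\<close> that \<open>m\<close> reaches,
  which turns the excess over \<open>s\<close> into tail events; the bound \<open>d\<close> keeps
  the sum finite.\<close>

lemma le_add_sum_of_bool:
  assumes "m \<le> s + d"
  shows "real m \<le> real s + (\<Sum>u<d. of_bool (s + Suc u \<le> m))"
proof -
  have "m - s = card {..<m - s}" by simp
  also have "\<dots> \<le> card ({..<d} \<inter> {u. s + Suc u \<le> m})"
    using assms by (intro card_mono) auto
  finally have "real (m - s) \<le> (\<Sum>u<d. of_bool (s + Suc u \<le> m))" by simp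
  then show ?thesis by simp
qed

lemma finite_uniform_matroid_indep: "finite X \<Longrightarrow> finite (uniform_matroid_indep X r)"
  by (rule finite_subset[of _ "Pow X"]) (auto simp: uniform_matroid_indep_def)

lemma finite_portfolios: "finite (portfolios n r k)"
  using finite_lists_length_eq[OF finite_uniform_matroid_indep[of "{1..n}" r], of k]
  by (simp add: portfolios_def conj_commute)

lemma realized_value_ge:
  assumes "S \<in> set P"
  shows "real (card (S \<inter> A)) \<le> realized_value P A"
  using assms by (simp add: realized_value_def)

lemma realized_value_attained:
  assumes "P \<noteq> []"
  obtains S where "S \<in> set P" "realized_value P A = real (card (S \<inter> A))"
proof -
  have "Max ((\<lambda>S. card (S \<inter> A)) ` set P) \<in> (\<lambda>S. card (S \<inter> A)) ` set P"
    using assms by (intro Max_in) auto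
  then show ?thesis using that by (auto simp: realized_value_def)
qed

text \<open>
  Elements before \<open>i\<close> contribute at most their expected number; the remaining parts of the \<open>k\<close> sets
  are dominated by \<open>k\<close> binomial variables, whose excess over \<open>s\<close> is bounded by a union bound
  and the memorylessness-type inequality \<open>binomial_tail_submultiplicative\<close>.
\<close>

lemma portfolio_value_le:
  assumes P: "P \<in> portfolios n r k" and k: "1 \<le> k"
    and p: "\<And>l. l \<in> {1..n} \<Longrightarrow> 0 \<le> p l \<and> p l \<le> 1"
    and i: "1 \<le> i" "i \<le> Suc n"
    and q: "0 \<le> q" "q \<le> 1" "\<And>l. l \<in> {i..n} \<Longrightarrow> p l \<le> q"
  shows "portfolio_value (active_set_pmf n p) P
    \<le> (\<Sum>l\<in>{1..<i}. p l) + real s + real k * (binomial_tail q r s * (real r * q))"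
proof -
  let ?D = "independent_subset {1..n} p"
  define T where "T j = P ! j \<inter> {i..n}" for j
  have fin: "finite (set_pmf ?D)" by (simp add: finite_set_independent_subset)
  have int: "integrable ?D f" for f :: "nat set \<Rightarrow> real"
    using fin by (rule integrable_measure_pmf_finite)
  have len: "length P = k" using P by (simp add: portfolios_def)
  have S: "P ! j \<subseteq> {1..n}" "card (P ! j) \<le> r" if "j < k" for j
  proof -
    have "P ! j \<in> set P" using that len by simp
    then show "P ! j \<subseteq> {1..n}" "card (P ! j) \<le> r"
      using P by (auto simp: portfolios_def uniform_matroid_indep_def)
  qed
  have cardT: "card (T j) \<le> r" if "j < k" for j
    using S[OF that] card_mono[of "P ! j" "T j"] finite_subset[of "P ! j" "{1..n}"]
    by (auto simp: T_def)
  have pointwise: "realized_value P A \<le> real (card ({1..<i} \<inter> A)) + real s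
      + (\<Sum>j<k. \<Sum>u<r. of_bool (s + Suc u \<le> card (T j \<inter> A)))" (is "_ \<le> ?rhs")
    if "A \<in> set_pmf ?D" for A
  proof -
    have "P \<noteq> []" using len k by auto
    then obtain S where "S \<in> set P" and SA: "realized_value P A = real (card (S \<inter> A))"
      by (rule realized_value_attained)
    then obtain j where j: "j < k" "S = P ! j" using len by (auto simp: in_set_conv_nth)
    have "S \<inter> A \<subseteq> ({1..<i} \<inter> A) \<union> (T j \<inter> A)"
      using S[OF j(1)] by (auto simp: T_def j)
    then have "card (S \<inter> A) \<le> card (({1..<i} \<inter> A) \<union> (T j \<inter> A))"
      by (intro card_mono) (auto simp: T_def)
    also have "\<dots> \<le> card ({1..<i} \<inter> A) + card (T j \<inter> A)" by (rule card_Un_le)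
    finally have "real (card (S \<inter> A)) \<le> real (card ({1..<i} \<inter> A)) + real (card (T j \<inter> A))"
      by linarith
    moreover have "card (T j \<inter> A) \<le> s + r"
      using cardT[OF j(1)] card_mono[OF _ Int_lower1, of "T j" A] by (simp add: T_def)
    then have "real (card (T j \<inter> A)) \<le> real s + (\<Sum>u<r. of_bool (s + Suc u \<le> card (T j \<inter> A)))"
      by (rule le_add_sum_of_bool)
    moreover have "(\<Sum>u<r. of_bool (s + Suc u \<le> card (T j \<inter> A)) :: real)
        \<le> (\<Sum>j<k. \<Sum>u<r. of_bool (s + Suc u \<le> card (T j \<inter> A)))"
      using j(1) by (intro member_le_sum) (auto intro: sum_nonneg)
    ultimately show ?thesis using SA by linarith
  qed
  have tail: "E ?D (\<lambda>A. of_bool (s + Suc u \<le> card (T j \<inter> A)))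
      \<le> binomial_tail q r s * binomial_tail q r (Suc u)" if "j < k" for j u
  proof -
    have "E ?D (\<lambda>A. of_bool (s + Suc u \<le> card (T j \<inter> A)))
        = E (independent_subset (T j) p) (\<lambda>A. of_bool (s + Suc u \<le> card A))"
      using S[OF that] by (intro expectation_independent_subset_Int) (auto simp: T_def)
    also have "\<dots> \<le> binomial_tail q (card (T j)) (s + Suc u)"
      using p q S[OF that] i by (intro tail_independent_subset_le) (auto simp: T_def)
    also have "\<dots> \<le> binomial_tail q r (s + Suc u)"
      using q cardT[OF that] by (intro binomial_tail_mono) auto
    also have "\<dots> \<le> binomial_tail q r s * binomial_tail q r (Suc u)"
      using q by (intro binomial_tail_submultiplicative) auto
    finally show ?thesis .
  qed
  have "portfolio_value (active_set_pmf n p) P \<le> E ?D (\<lambda>A. real (card ({1..<i} \<inter> A)) + real s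
      + (\<Sum>j<k. \<Sum>u<r. of_bool (s + Suc u \<le> card (T j \<inter> A))))"
    unfolding portfolio_value_def active_set_pmf_eq
    using fin pointwise by (rule expectation_mono_finite)
  also have "\<dots> = E ?D (\<lambda>A. real (card ({1..<i} \<inter> A))) + real s
      + (\<Sum>j<k. \<Sum>u<r. E ?D (\<lambda>A. of_bool (s + Suc u \<le> card (T j \<inter> A))))"
    by (simp add: int del: One_nat_def sum_of_bool_eq)
  also have "E ?D (\<lambda>A. real (card ({1..<i} \<inter> A))) = (\<Sum>l\<in>{1..<i}. p l)"
    using i p by (subst expectation_independent_subset_Int)
      (auto intro!: expectation_card_independent_subset)
  also have "(\<Sum>j<k. \<Sum>u<r. E ?D (\<lambda>A. of_bool (s + Suc u \<le> card (T j \<inter> A))))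
      \<le> (\<Sum>j<k. \<Sum>u<r. binomial_tail q r s * binomial_tail q r (Suc u))"
    by (intro sum_mono tail) auto
  also have "\<dots> = real k * (binomial_tail q r s * (\<Sum>u<r. binomial_tail q r (Suc u)))"
    by (simp add: sum_distrib_left)
  also have "\<dots> \<le> real k * (binomial_tail q r s * (real r * q))"
    using q by (intro mult_left_mono sum_binomial_tail_le binomial_tail_bounds) auto
  finally show ?thesis by simp
qed

section \<open>Lower bound for the random portfolio of a prefix\<close>

lemma set_random_portfolio_subset:
  assumes "i \<in> {1..n}"
  shows "set_pmf (random_portfolio r k i) \<subseteq> portfolios n r k"
proof
  fix Q assume "Q \<in> set_pmf (random_portfolio r k i)"
  then have len: "length Q = k" and sub: "set Q \<subseteq> set_pmf (random_set r i)"
    by (auto simp: random_portfolio_def set_replicate_pmf)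
  have "S \<in> uniform_matroid_indep {1..n} r" if "S \<in> set_pmf (random_set r i)" for S
  proof -
    from that obtain xs where "S = set xs" "length xs = r" "set xs \<subseteq> {1..i}"
      using assms by (auto simp: random_set_def set_replicate_pmf)
    then show ?thesis
      using assms card_length[of xs] by (auto simp: uniform_matroid_indep_def)
  qed
  then show "Q \<in> portfolios n r k"
    using len sub by (auto simp: portfolios_def)
qed

text \<open>Fix an active set with at least \<open>u\<close> elements in the prefix. The
  \<open>k\<close> random sets are independent of it and of each other, and each reaches
  \<open>t\<close> active elements with probability at least the binomial tail; then the value is at
  least \<open>t\<close> if any of them does.\<close>

lemma random_portfolio_value_ge:
  assumes i: "i \<in> {1..n}" and \<rho>: "0 \<le> \<rho>" "\<rho> \<le> 1" "\<rho> * real i \<le> real u - real t" and tu: "t \<le> u"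
  shows "real t * (1 - (1 - binomial_tail \<rho> r t) ^ k)
      * E (independent_subset {1..i} p) (\<lambda>A. of_bool (u \<le> card A))
    \<le> E (random_portfolio r k i) (portfolio_value (active_set_pmf n p))"
proof -
  let ?D = "independent_subset {1..n} p"
  let ?f = "1 - (1 - binomial_tail \<rho> r t) ^ k"
  have fin: "finite (set_pmf ?D)" by (simp add: finite_set_independent_subset)
  have finR: "finite (set_pmf (random_set r i))"
    using i by (simp add: random_set_def finite_set_replicate_pmf)
  have finP: "finite (set_pmf (random_portfolio r k i))"
    unfolding random_portfolio_def using finR by (rule finite_set_replicate_pmf)
  have f: "0 \<le> ?f"
    using binomial_tail_bounds[OF \<rho>(1,2), of r t] by (simp add: power_le_one)
  have pointwise: "real t * ?f * of_bool (u \<le> card ({1..i} \<inter> A))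
      \<le> E (random_portfolio r k i) (\<lambda>P. realized_value P A)" if "A \<in> set_pmf ?D" for A
  proof -
    have A: "A \<subseteq> {1..n}" using that set_independent_subset by blast
    have rv: "real t * of_bool (\<exists>S\<in>set P. t \<le> card (S \<inter> A)) \<le> realized_value P A"
      if "P \<in> set_pmf (random_portfolio r k i)" for P
    proof (cases "\<exists>S\<in>set P. t \<le> card (S \<inter> A)")
      case True
      then obtain S where "S \<in> set P" "t \<le> card (S \<inter> A)" by blast
      then show ?thesis using realized_value_ge[of S P A] True by simp
    qed (simp add: realized_value_def)
    let ?g = "E (random_set r i) (\<lambda>S. of_bool (t \<le> card (S \<inter> A)))"
    have "real t * ?f * of_bool (u \<le> card ({1..i} \<inter> A)) \<le> real t * (1 - (1 - ?g) ^ k)"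
    proof (cases "u \<le> card ({1..i} \<inter> A)")
      case True
      have "binomial_tail \<rho> r t \<le> E (random_set r i) (\<lambda>S. of_bool (t \<le> card (S \<inter> ({1..i} \<inter> A))))"
        using i \<rho> tu True by (intro tail_random_set_ge) auto
      also have "\<dots> \<le> ?g"
      proof (rule expectation_mono_finite[OF finR])
        fix S
        have "card (S \<inter> ({1..i} \<inter> A)) \<le> card (S \<inter> A)"
          using A by (intro card_mono) (auto intro: finite_subset)
        then show "of_bool (t \<le> card (S \<inter> ({1..i} \<inter> A))) \<le> (of_bool (t \<le> card (S \<inter> A)) :: real)"
          by auto
      qed
      finally have "binomial_tail \<rho> r t \<le> ?g" .
      moreover have "?g \<le> E (random_set r i) (\<lambda>_. 1)"
        by (rule expectation_mono_finite[OF finR]) auto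
      ultimately have "(1 - ?g) ^ k \<le> (1 - binomial_tail \<rho> r t) ^ k"
        by (intro power_mono) auto
      then show ?thesis using True by (simp add: mult_left_mono)
    next
      case False
      have "0 \<le> ?g" by simp
      moreover have "?g \<le> E (random_set r i) (\<lambda>_. 1)"
        by (rule expectation_mono_finite[OF finR]) auto
      ultimately show ?thesis using False by (simp add: power_le_one)
    qed
    also have "\<dots> = E (random_portfolio r k i) (\<lambda>P. real t * of_bool (\<exists>S\<in>set P. t \<le> card (S \<inter> A)))"
      unfolding random_portfolio_def using finR by (simp add: expectation_ex_replicate_pmf)
    also have "\<dots> \<le> E (random_portfolio r k i) (\<lambda>P. realized_value P A)"
      using finP rv by (rule expectation_mono_finite)
    finally show ?thesis .
  qed
  have "real t * ?f * E (independent_subset {1..i} p) (\<lambda>A. of_bool (u \<le> card A))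
      = real t * ?f * E ?D (\<lambda>A. of_bool (u \<le> card ({1..i} \<inter> A)))"
    using i by (subst expectation_independent_subset_Int) auto
  also have "\<dots> = E ?D (\<lambda>A. real t * ?f * of_bool (u \<le> card ({1..i} \<inter> A)))"
    by simp
  also have "\<dots> \<le> E ?D (\<lambda>A. E (random_portfolio r k i) (\<lambda>P. realized_value P A))"
    using fin pointwise by (rule expectation_mono_finite)
  \<comment> \<open>The bound was proved for each active set; exchanging the two expectations gives
    the expected portfolio value.\<close>
  also have "\<dots> = E (random_portfolio r k i) (portfolio_value (active_set_pmf n p))"
    unfolding portfolio_value_def active_set_pmf_eq using fin finP by (rule expectation_swap)
  finally show ?thesis .
qed

text \<open>Here (1 - f) to the power k is at most exp (- k f), hence at most exp (- 1/4), and exp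
  (1/4) is at least 5/4.\<close>

lemma one_minus_power_ge:
  assumes "0 \<le> f" "f \<le> 1" "1 / 4 \<le> real k * f"
  shows "1 / 5 \<le> 1 - (1 - f) ^ k"
proof -
  have "(1 - f) ^ k \<le> exp (- f) ^ k"
    using assms exp_ge_add_one_self[of "- f"] by (intro power_mono) auto
  also have "\<dots> = exp (- (real k * f))" by (simp add: exp_of_nat_mult[symmetric])
  also have "\<dots> \<le> exp (- (1 / 4))" using assms by simp
  also have "\<dots> \<le> 4 / 5"
    using exp_ge_add_one_self[of "1 / 4 :: real"] by (simp add: exp_minus field_simps)
  finally show ?thesis by simp
qed

lemma exists_good_prefix:
  assumes P: "P \<in> portfolios n r k" and k: "1 \<le> k"
    and p: "\<And>l. l \<in> {1..n} \<Longrightarrow> 0 \<le> p l \<and> p l \<le> 1"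
    and decr: "\<And>i j. i \<in> {1..n} \<Longrightarrow> j \<in> {1..n} \<Longrightarrow> i \<le> j \<Longrightarrow> p j \<le> p i"
    and V: "200 \<le> portfolio_value (active_set_pmf n p) P"
  shows "\<exists>i\<in>{1..n}. portfolio_value (active_set_pmf n p) P / 1000
    \<le> E (random_portfolio r k i) (portfolio_value (active_set_pmf n p))"
proof -
  define V where "V = portfolio_value (active_set_pmf n p) P"
  define a where "a j = (\<Sum>l\<in>{1..j}. p l)" for j
  have V200: "200 \<le> V" using V by (simp add: V_def)
  \<comment> \<open>With \<open>Suc n\<close> as the cut every element is an early one, so the bound
    reduces to the expected number of active elements.\<close>
  have "V \<le> a n"
    using portfolio_value_le[OF P k, of p "Suc n" 0 0] p
    by (simp add: V_def a_def atLeastLessThanSuc_atLeastAtMost)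
  then have ex: "V / 4 \<le> a n" using V200 by simp
  define i where "i = (LEAST j. V / 4 \<le> a j)"
  have ai: "V / 4 \<le> a i" unfolding i_def using ex by (rule LeastI)
  have "i \<noteq> 0"
  proof
    assume "i = 0"
    then show False using ai V200 by (simp add: a_def)
  qed
  moreover have "i \<le> n" unfolding i_def using ex by (rule Least_le)
  ultimately have i: "i \<in> {1..n}" by simp
  have "\<not> V / 4 \<le> a (i - 1)"
    using \<open>i \<noteq> 0\<close> unfolding i_def by (intro not_less_Least) auto
  moreover have "{1..<i} = {1..i - 1}" using \<open>i \<noteq> 0\<close> by auto
  ultimately have before: "(\<Sum>l\<in>{1..<i}. p l) \<le> V / 4" by (simp add: a_def)
  define q where "q = a i / real i"
  have qi: "q * real i = a i" using \<open>i \<noteq> 0\<close> by (simp add: q_def)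
  have q0: "0 \<le> q" using ai V200 by (simp add: q_def)
  have "a i \<le> real (card {1..i}) * 1"
    unfolding a_def using p i by (intro sum_bounded_above) auto
  then have q1: "q \<le> 1" using \<open>i \<noteq> 0\<close> by (simp add: q_def)
  \<comment> \<open>By monotonicity \<open>p l\<close> is at most each of \<open>p 1\<close>, ...,
    \<open>p i\<close>, hence at most their average \<open>q\<close>.\<close>
  have pq: "p l \<le> q" if "l \<in> {i..n}" for l
  proof -
    have "real (card {1..i}) * p l \<le> a i"
      unfolding a_def using that i by (intro sum_bounded_below decr) auto
    then show ?thesis using \<open>i \<noteq> 0\<close> by (simp add: q_def field_simps)
  qed
  define s where "s = nat \<lfloor>V / 4\<rfloor>"
  have s: "real s \<le> V / 4" "V / 4 - 1 \<le> real s"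
    using V200 by (simp_all add: s_def) linarith
  then have s50: "50 \<le> s" using V200 by (simp add: s_def le_nat_floor)
  let ?b = "binomial_tail q r s"
  have "V \<le> (\<Sum>l\<in>{1..<i}. p l) + real s + real k * (?b * (real r * q))"
    unfolding V_def using i by (intro portfolio_value_le[OF P k p] q0 q1 pq) auto
  \<comment> \<open>The early elements and the threshold \<open>s\<close> each take at most V / 4,
    so half of \<open>V\<close> must come from the excess.\<close>
  then have excess: "V / 2 \<le> real k * ?b * (real r * q)"
    using before s by simp
  have b0: "0 \<le> ?b" using q0 q1 by (rule binomial_tail_bounds)
  \<comment> \<open>If the mean r q is at most \<open>V\<close>, dividing the excess bound by
    \<open>V\<close> suffices. Otherwise the mean exceeds 4 s, and a single tail is already at least
    1/2.\<close>
  have kb: "1 / 2 \<le> real k * ?b"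
  proof (cases "real r * q \<le> V")
    case True
    have "V * (1 / 2) \<le> real k * ?b * (real r * q)" using excess by simp
    also have "\<dots> \<le> real k * ?b * V"
      using True b0 by (intro mult_left_mono) auto
    finally have "V * (1 / 2) \<le> V * (real k * ?b)" by (simp add: algebra_simps)
    then show ?thesis using V200 by (subst (asm) mult_le_cancel_left_pos) auto
  next
    case False
    then have "1 / 2 \<le> ?b"
      using s s50 q0 q1 by (intro binomial_tail_ge_half) auto
    also have "\<dots> \<le> real k * ?b" using k b0 by (simp add: mult_le_cancel_right1)
    finally show ?thesis .
  qed
  \<comment> \<open>The divisor 16 makes the mean s / 4 of Bin(s, 1/4) at least 4 t, as
    \<open>binomial_tail_ge_half\<close> requires.\<close>
  define t where "t = s div 16"
  have t: "16 * t \<le> s" "s \<le> 16 * t + 15" by (simp_all add: t_def)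
  have t1: "1 \<le> t" using s50 t by linarith
  define \<rho> where "\<rho> = 1 / 4 * q"
  have \<rho>: "0 \<le> \<rho>" "\<rho> \<le> 1" using q0 q1 by (simp_all add: \<rho>_def)
  have "?b * (1 / 2) \<le> ?b * binomial_tail (1 / 4) s t"
    using t t1 b0 by (intro mult_left_mono binomial_tail_ge_half) auto
  also have "\<dots> \<le> binomial_tail \<rho> r t"
    unfolding \<rho>_def using q0 q1 by (intro binomial_tail_thinning) auto
  finally have "real k * (?b * (1 / 2)) \<le> real k * binomial_tail \<rho> r t"
    by (intro mult_left_mono) auto
  then have reach: "1 / 5 \<le> 1 - (1 - binomial_tail \<rho> r t) ^ k"
    using kb binomial_tail_bounds[OF \<rho>] by (intro one_minus_power_ge) auto
  \<comment> \<open>Since t is at most V / 64 and so at most \<open>a i / 16\<close>, the fraction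
    5/16 = 1/4 + 1/16 leaves \<open>a i / 4\<close>, which is \<rho> times i, after \<open>t\<close>
    elements are collected. It also lies far enough below 1/2 for the tail bound on the active
    set.\<close>
  define u where "u = nat \<lceil>5 / 16 * a i\<rceil>"
  have u: "5 / 16 * a i \<le> real u" "real u \<le> 5 / 16 * a i + 1"
    using ai V200 by (simp_all add: u_def)
  \<comment> \<open>Rounding twice costs less than 1 + 15/16 - 15/16 + 1/16 would suggest only for
    large \<open>V\<close>: t is at least V / 64 - 1, and this is at least V / 100 because
    \<open>V\<close> is at least 200.\<close>
  have tV: "real t \<le> V / 64" "V / 100 \<le> real t" using t s V200 by linarith+
  have "real t \<le> real u" using u tV ai V200 by linarith
  then have tu: "t \<le> u" by simp
  have \<rho>i: "\<rho> * real i \<le> real u - real t"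
    using u tV ai qi by (simp add: \<rho>_def)
  let ?g = "E (independent_subset {1..i} p) (\<lambda>A. of_bool (u \<le> card A))"
  have "1 - ?g \<le> 2 ^ u * exp (- a i / 2)"
    unfolding a_def using p i by (intro tail_independent_subset_ge) auto
  also have "\<dots> \<le> exp (real u) * exp (- a i / 2)"
    by (intro mult_right_mono two_power_le_exp) simp
  also have "\<dots> = exp (real u - a i / 2)" by (simp add: exp_add[symmetric])
  also have "\<dots> \<le> exp (- 1)" using u ai V200 by simp
  finally have g: "1 / 2 \<le> ?g" using exp_neg_one_le_half by linarith
  \<comment> \<open>The constant 1/1000 is the product of the value \<open>t\<close>, the chance 1/5
    that some set reaches it, and the chance 1/2 of enough active elements.\<close>
  have "V / 100 * (1 / 5) * (1 / 2) \<le> real t * (1 - (1 - binomial_tail \<rho> r t) ^ k) * ?g"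
    using reach g tV V200 by (intro mult_mono) auto
  also have "\<dots> \<le> E (random_portfolio r k i) (portfolio_value (active_set_pmf n p))"
    using i \<rho> \<rho>i tu by (rule random_portfolio_value_ge)
  finally show ?thesis using i by (auto simp: V_def)
qed

subsection \<open>Estimation and selection\<close>

text \<open>Additivity of the variance for independent centred summands: expanding the square of the
  sum, the cross terms vanish because the means are 0.\<close>

lemma expectation_sum_list_replicate:
  fixes g :: "'a \<Rightarrow> real"
  assumes "finite (set_pmf M)" "E M g = 0"
  shows "E (replicate_pmf N M) (\<lambda>xs. \<Sum>x\<leftarrow>xs. g x) = 0"
    and "E (replicate_pmf N M) (\<lambda>xs. (\<Sum>x\<leftarrow>xs. g x)\<^sup>2) = real N * E M (\<lambda>x. (g x)\<^sup>2)"
proof -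
  have int: "integrable (replicate_pmf N M) f" for f :: "'a list \<Rightarrow> real" and N
    using assms(1) by (intro integrable_measure_pmf_finite finite_set_replicate_pmf)
  have intM: "integrable M f" for f :: "'a \<Rightarrow> real"
    using assms(1) by (rule integrable_measure_pmf_finite)
  have mean: "E (replicate_pmf N M) (\<lambda>xs. \<Sum>x\<leftarrow>xs. g x) = 0" for N
  proof (induction N)
    case (Suc N)
    then show ?case
      using assms by (simp add: expectation_replicate_pmf_Suc int intM del: replicate_pmf.simps)
  qed simp
  then show "E (replicate_pmf N M) (\<lambda>xs. \<Sum>x\<leftarrow>xs. g x) = 0" .
  show "E (replicate_pmf N M) (\<lambda>xs. (\<Sum>x\<leftarrow>xs. g x)\<^sup>2) = real N * E M (\<lambda>x. (g x)\<^sup>2)"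
  proof (induction N)
    case (Suc N)
    have "E (replicate_pmf N M) (\<lambda>xs. (\<Sum>y\<leftarrow>x # xs. g y)\<^sup>2)
        = (g x)\<^sup>2 + real N * E M (\<lambda>x. (g x)\<^sup>2)" for x
      using Suc mean[of N] by (simp add: power2_sum int algebra_simps)
    then show ?case
      using assms by (simp add: expectation_replicate_pmf_Suc intM algebra_simps del: replicate_pmf.simps)
  qed simp
qed

text \<open>AM-GM: \<open>2 \<bar>x\<bar> \<le> \<epsilon> x\<^sup>2 + 1 / \<epsilon>\<close>; this replaces Jensen's inequality.\<close>

lemma expectation_abs_le:
  fixes f :: "'a \<Rightarrow> real"
  assumes "finite (set_pmf M)" "0 < \<epsilon>"
  shows "E M (\<lambda>x. \<bar>f x\<bar>) \<le> (\<epsilon> * E M (\<lambda>x. (f x)\<^sup>2) + 1 / \<epsilon>) / 2"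
proof -
  have "\<bar>y\<bar> \<le> (\<epsilon> * y\<^sup>2 + 1 / \<epsilon>) / 2" for y :: real
  proof -
    have "0 \<le> (\<epsilon> * \<bar>y\<bar> - 1)\<^sup>2 / \<epsilon>" using assms(2) by simp
    also have "\<dots> = \<epsilon> * y\<^sup>2 + 1 / \<epsilon> - 2 * \<bar>y\<bar>"
      using assms(2) by (simp add: power2_eq_square field_simps)
    finally show ?thesis by simp
  qed
  then have "E M (\<lambda>x. \<bar>f x\<bar>) \<le> E M (\<lambda>x. (\<epsilon> * (f x)\<^sup>2 + 1 / \<epsilon>) / 2)"
    using assms(1) by (intro expectation_mono_finite)
  also have "\<dots> = (\<epsilon> * E M (\<lambda>x. (f x)\<^sup>2) + 1 / \<epsilon>) / 2"
    using assms(1) by (simp add: integrable_measure_pmf_finite)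
  finally show ?thesis .
qed

text \<open>Centring the values at their mean keeps them within \<open>B\<close> in absolute value,
  so the average of \<open>N\<close> samples has variance at most B^2 / N;
  \<open>expectation_abs_le\<close> turns this into a mean absolute error.\<close>

lemma expectation_estimate_error_le:
  assumes D: "finite (set_pmf D)" and N: "1 \<le> N" and \<epsilon>: "0 < \<epsilon>"
    and B: "\<And>A. A \<in> set_pmf D \<Longrightarrow> 0 \<le> realized_value P A \<and> realized_value P A \<le> B"
  shows "E (estimate_value N D P) (\<lambda>x. \<bar>x - portfolio_value D P\<bar>) \<le> (\<epsilon> * (B\<^sup>2 / real N) + 1 / \<epsilon>) / 2"
proof -
  define \<mu> where "\<mu> = portfolio_value D P"
  define g where "g A = realized_value P A - \<mu>" for A
  have int: "integrable D f" for f :: "nat set \<Rightarrow> real"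
    using D by (rule integrable_measure_pmf_finite)
  have \<mu>: "0 \<le> \<mu>" "\<mu> \<le> B"
  proof -
    have "E D (\<lambda>_. 0) \<le> \<mu>" "\<mu> \<le> E D (\<lambda>_. B)"
      unfolding \<mu>_def portfolio_value_def using B D by (blast intro: expectation_mono_finite)+
    then show "0 \<le> \<mu>" "\<mu> \<le> B" by simp_all
  qed
  have "E D (\<lambda>A. realized_value P A - \<mu>) = 0" by (simp add: int \<mu>_def portfolio_value_def)
  then have "E D g = 0" by (simp add: g_def[abs_def])
  note var = expectation_sum_list_replicate(2)[OF D this, of N]
  have "E D (\<lambda>A. (g A)\<^sup>2) \<le> E D (\<lambda>_. B\<^sup>2)"
  proof (rule expectation_mono_finite[OF D])
    fix A assume "A \<in> set_pmf D"
    then have "\<bar>g A\<bar> \<le> B" using B[of A] \<mu> by (auto simp: g_def)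
    then show "(g A)\<^sup>2 \<le> B\<^sup>2" by (metis abs_ge_zero power2_abs power_mono)
  qed
  then have gB: "E D (\<lambda>A. (g A)\<^sup>2) \<le> B\<^sup>2" by simp
  have "(\<Sum>A\<leftarrow>As. realized_value P A) / real N - \<mu> = (\<Sum>A\<leftarrow>As. g A) / real N"
    if "As \<in> set_pmf (replicate_pmf N D)" for As
  proof -
    have "length As = N" using that by (simp add: set_replicate_pmf)
    then show ?thesis
      using N by (simp add: g_def sum_list_subtractf sum_list_triv field_simps)
  qed
  then have "E (estimate_value N D P) (\<lambda>x. \<bar>x - \<mu>\<bar>)
      = E (replicate_pmf N D) (\<lambda>As. \<bar>(\<Sum>A\<leftarrow>As. g A) / real N\<bar>)"
    unfolding estimate_value_def integral_map_pmf
    by (intro integral_cong_AE AE_pmfI) simp_all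
  also have "\<dots> \<le> (\<epsilon> * E (replicate_pmf N D) (\<lambda>As. ((\<Sum>A\<leftarrow>As. g A) / real N)\<^sup>2) + 1 / \<epsilon>) / 2"
    using \<epsilon> D by (intro expectation_abs_le finite_set_replicate_pmf)
  also have "E (replicate_pmf N D) (\<lambda>As. ((\<Sum>A\<leftarrow>As. g A) / real N)\<^sup>2)
      = real N * E D (\<lambda>A. (g A)\<^sup>2) / (real N)\<^sup>2"
    by (simp add: power_divide var)
  also have "\<dots> = E D (\<lambda>A. (g A)\<^sup>2) / real N"
    by (simp add: power2_eq_square)
  also have "(\<epsilon> * (E D (\<lambda>A. (g A)\<^sup>2) / real N) + 1 / \<epsilon>) / 2 \<le> (\<epsilon> * (B\<^sup>2 / real N) + 1 / \<epsilon>) / 2"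
    using gB \<epsilon> by (intro divide_right_mono add_mono mult_left_mono) auto
  finally show ?thesis by (simp add: \<mu>_def)
qed

text \<open>A maximizer exists on a finite nonempty set, so the unspecified choice returns one,
  however ties are broken.\<close>

lemma arg_max_on_finite:
  fixes f :: "'a \<Rightarrow> 'b :: linorder"
  assumes "finite S" "i \<in> S"
  shows "arg_max_on f S \<in> S" "f i \<le> f (arg_max_on f S)"
proof -
  obtain m where "m \<in> S" "\<And>x. x \<in> S \<Longrightarrow> f x \<le> f m"
    using assms obtains_MAX[of S f] by (metis Max_ge empty_iff finite_imageI imageI)
  then have "is_arg_max f (\<lambda>x. x \<in> S) m" by (simp add: is_arg_max_linorder)
  then have "is_arg_max f (\<lambda>x. x \<in> S) (arg_max_on f S)"
    unfolding arg_max_on_def arg_max_def by (rule someI)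
  then show "arg_max_on f S \<in> S" "f i \<le> f (arg_max_on f S)"
    using assms(2) by (simp_all add: is_arg_max_linorder)
qed

text \<open>The selected \<open>j\<close> has an estimate no smaller than that of \<open>i\<close>,
  so its true value falls short by at most the errors at \<open>i\<close> and \<open>j\<close>. Each
  is at most the sum of all \<open>n\<close> errors, whose expectation is at most n
  \<delta>.\<close>

lemma portfolio_algorithm_value_ge:
  assumes D: "finite (set_pmf D)" and i: "i \<in> {1..n}"
    and \<delta>: "\<And>P. P \<in> portfolios n r k \<Longrightarrow> E (estimate_value N D P) (\<lambda>x. \<bar>x - portfolio_value D P\<bar>) \<le> \<delta>"
  shows "E (random_portfolio r k i) (portfolio_value D) - 2 * real n * \<delta>
    \<le> E (portfolio_algorithm n r k D N) (portfolio_value D)"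
proof -
  let ?PP = "Pi_pmf {1..n} [] (random_portfolio r k)"
  let ?est = "\<lambda>P. Pi_pmf {1..n} 0 (\<lambda>l. estimate_value N D (P l))"
  let ?val = "portfolio_value D"
  have finP: "finite (set_pmf ?PP)"
    using finite_subset[OF set_random_portfolio_subset finite_portfolios]
    by (intro finite_set_Pi_pmf) auto
  have fine: "finite (set_pmf (?est P))" for P
    using D by (intro finite_set_Pi_pmf) (auto simp: estimate_value_def finite_set_replicate_pmf)
  have inP: "P l \<in> portfolios n r k" if "P \<in> set_pmf ?PP" "l \<in> {1..n}" for P l
    using that set_random_portfolio_subset[of l n r k] by (auto simp: set_Pi_pmf PiE_dflt_def)
  have "?val (P i) - 2 * real n * \<delta> \<le> E (?est P) (\<lambda>est. ?val (P (arg_max_on est {1..n})))"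
    if P: "P \<in> set_pmf ?PP" for P
  proof -
    have "?val (P i) - 2 * (\<Sum>l\<in>{1..n}. \<bar>est l - ?val (P l)\<bar>) \<le> ?val (P (arg_max_on est {1..n}))" for est
    proof -
      define j where "j = arg_max_on est {1..n}"
      have j: "j \<in> {1..n}" "est i \<le> est j"
        unfolding j_def using i by (auto intro: arg_max_on_finite simp del: atLeastAtMost_iff)
      have dev: "\<bar>est l - ?val (P l)\<bar> \<le> (\<Sum>l\<in>{1..n}. \<bar>est l - ?val (P l)\<bar>)" if "l \<in> {1..n}" for l
        using that by (intro member_le_sum) auto
      show ?thesis using dev[OF i] dev[OF j(1)] j(2) unfolding j_def[symmetric] by linarith
    qed
    then have "E (?est P) (\<lambda>est. ?val (P i) - 2 * (\<Sum>l\<in>{1..n}. \<bar>est l - ?val (P l)\<bar>))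
        \<le> E (?est P) (\<lambda>est. ?val (P (arg_max_on est {1..n})))"
      by (intro expectation_mono_finite fine)
    moreover have "E (?est P) (\<lambda>est. ?val (P i) - 2 * (\<Sum>l\<in>{1..n}. \<bar>est l - ?val (P l)\<bar>))
        = ?val (P i) - 2 * (\<Sum>l\<in>{1..n}. E (?est P) (\<lambda>est. \<bar>est l - ?val (P l)\<bar>))"
      by (simp add: integrable_measure_pmf_finite[OF fine] del: One_nat_def)
    moreover have "(\<Sum>l\<in>{1..n}. E (?est P) (\<lambda>est. \<bar>est l - ?val (P l)\<bar>)) \<le> (\<Sum>l\<in>{1..n}. \<delta>)"
    proof (intro sum_mono)
      fix l assume l: "l \<in> {1..n}"
      have "E (?est P) (\<lambda>est. \<bar>est l - ?val (P l)\<bar>) = E (estimate_value N D (P l)) (\<lambda>x. \<bar>x - ?val (P l)\<bar>)"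
        using l by (subst expectation_Pi_pmf_component[where f = "\<lambda>x. \<bar>x - ?val (P l)\<bar>"]) auto
      also have "\<dots> \<le> \<delta>" using inP[OF P l] by (rule \<delta>)
      finally show "E (?est P) (\<lambda>est. \<bar>est l - ?val (P l)\<bar>) \<le> \<delta>" .
    qed
    ultimately show ?thesis by simp
  qed
  then have "E ?PP (\<lambda>P. ?val (P i) - 2 * real n * \<delta>)
      \<le> E ?PP (\<lambda>P. E (?est P) (\<lambda>est. ?val (P (arg_max_on est {1..n}))))"
    by (intro expectation_mono_finite finP)
  also have "\<dots> = E (portfolio_algorithm n r k D N) ?val"
    unfolding portfolio_algorithm_def
    by (simp add: expectation_bind_pmf_finite finP fine del: One_nat_def flip: map_pmf_def)
  also have "E ?PP (\<lambda>P. ?val (P i) - 2 * real n * \<delta>) = E (random_portfolio r k i) ?val - 2 * real n * \<delta>"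
    by (simp add: integrable_measure_pmf_finite[OF finP]
        expectation_Pi_pmf_component[OF finite_atLeastAtMost i] del: One_nat_def)
  finally show ?thesis .
qed

lemma realized_value_bounds:
  assumes "P \<in> portfolios n r k" "1 \<le> k" "A \<subseteq> {1..n}"
  shows "0 \<le> realized_value P A \<and> realized_value P A \<le> real n"
proof -
  have "P \<noteq> []" using assms by (auto simp: portfolios_def)
  then obtain S where "realized_value P A = real (card (S \<inter> A))"
    by (rule realized_value_attained)
  moreover have "card (S \<inter> A) \<le> card {1..n}"
    using assms(3) by (intro card_mono) auto
  ultimately show ?thesis by simp
qed

lemma OPT_attained:
  obtains P where "P \<in> portfolios n r k" "OPT n r k D = portfolio_value D P"
proof -
  have "replicate k {} \<in> portfolios n r k"
    by (auto simp: portfolios_def uniform_matroid_indep_def)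
  then have "OPT n r k D \<in> portfolio_value D ` portfolios n r k"
    unfolding OPT_def by (intro Max_in finite_imageI finite_portfolios) auto
  then show ?thesis using that by auto
qed

text \<open>A good prefix yields OPT / 1000, and the selection loses at most 1/20, which is below
  OPT / 2000 because OPT is at least 200. This leaves the factor 1/2000 whenever each estimate uses
  at least 1600 n^4 samples.\<close>

theorem theorem4p6:
  shows "\<exists>c::real. c > 0 \<and>
    (\<exists>a b :: nat. \<forall>(n::nat) (r::nat) (k::nat) (p :: nat \<Rightarrow> real).
       r \<le> n \<longrightarrow> k \<ge> 1 \<longrightarrow>
       (\<forall>i\<in>{1..n}. 0 \<le> p i \<and> p i \<le> 1) \<longrightarrow>
       (\<forall>i\<in>{1..n}. \<forall>j\<in>{1..n}. i \<le> j \<longrightarrow> p j \<le> p i) \<longrightarrow>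
       OPT n r k (active_set_pmf n p) \<ge> 200 \<longrightarrow>
       (\<forall>N \<ge> a * n ^ b.
          measure_pmf.expectation (portfolio_algorithm n r k (active_set_pmf n p) N)
            (portfolio_value (active_set_pmf n p))
          \<ge> c * OPT n r k (active_set_pmf n p)))"
proof (rule exI[of _ "1 / 2000"], rule conjI, simp, rule exI[of _ 1600], rule exI[of _ 4], intro allI impI)
  fix n r k :: nat and p :: "nat \<Rightarrow> real" and N :: nat
  assume k: "1 \<le> k"
    and p: "\<forall>i\<in>{1..n}. 0 \<le> p i \<and> p i \<le> 1"
    and decr: "\<forall>i\<in>{1..n}. \<forall>j\<in>{1..n}. i \<le> j \<longrightarrow> p j \<le> p i"
    and V: "200 \<le> OPT n r k (active_set_pmf n p)"
    and N: "1600 * n ^ 4 \<le> N"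
  let ?D = "active_set_pmf n p"
  have D: "finite (set_pmf ?D)" "\<And>A. A \<in> set_pmf ?D \<Longrightarrow> A \<subseteq> {1..n}"
    using set_independent_subset[of "{1..n}" p]
    by (auto simp: active_set_pmf_eq finite_set_independent_subset)
  obtain P where P: "P \<in> portfolios n r k" "OPT n r k ?D = portfolio_value ?D P"
    by (rule OPT_attained)
  obtain i where i: "i \<in> {1..n}"
    and val: "OPT n r k ?D / 1000 \<le> E (random_portfolio r k i) (portfolio_value ?D)"
    using exists_good_prefix[OF P(1) k, of p] p decr V P(2) by auto
  have n: "1 \<le> n" using i by auto
  have "1 \<le> 1600 * n ^ 4" using n by simp
  then have N1: "1 \<le> N" using N by linarith
  have "real (1600 * n ^ 4) \<le> real N" using N by (rule of_nat_mono)
  then have N': "1600 * real n ^ 4 \<le> real N" by simp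
  \<comment> \<open>The accuracy 1 / (40 n) makes the total loss 2 n / (40 n) = 1/20.\<close>
  have "E (estimate_value N ?D Q) (\<lambda>x. \<bar>x - portfolio_value ?D Q\<bar>) \<le> 1 / (40 * real n)"
    if Q: "Q \<in> portfolios n r k" for Q
  proof -
    have "E (estimate_value N ?D Q) (\<lambda>x. \<bar>x - portfolio_value ?D Q\<bar>)
        \<le> ((40 * real n) * ((real n)\<^sup>2 / real N) + 1 / (40 * real n)) / 2"
      using n N1 realized_value_bounds[OF Q k] D by (intro expectation_estimate_error_le) auto
    \<comment> \<open>With \<epsilon> = 40 n and B = n, the sample size 1600 n^4 balances the two
      terms of the error bound.\<close>
    also have "(40 * real n) * ((real n)\<^sup>2 / real N) \<le> 1 / (40 * real n)"
      using N' N1 n by (simp add: field_simps eval_nat_numeral)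
    finally show ?thesis by simp
  qed
  from portfolio_algorithm_value_ge[OF D(1) i this]
  have "E (random_portfolio r k i) (portfolio_value ?D) - 2 * real n * (1 / (40 * real n))
      \<le> E (portfolio_algorithm n r k ?D N) (portfolio_value ?D)" .
  moreover have "2 * real n * (1 / (40 * real n)) = 1 / 20" using n by simp
  ultimately show "1 / 2000 * OPT n r k ?D \<le> E (portfolio_algorithm n r k ?D N) (portfolio_value ?D)"
    using val V by linarith
qed

end
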